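(* Let $P$ be any probability distribution on $L_2[0,1]$, let $X_1,\dots,X_n,X_{n+1}$ be i.i.d. random functions with distribution $P$, let $\alpha\in(0,1)$ and $1\le n_1<n$. Let $\phi_1,\dots,\phi_p$ be orthonormal functions in $L_2[0,1]$, and let $\Pi_p$ be the induced projection operator, $(\Pi_pX)(t)=\sum_{j=1}^p\langle X,\phi_j\rangle\,\phi_j(t)$. Let $B_n(t)\subseteq\mathbb{R}$, $t\in[0,1]$, be the output of the functional conformal prediction band algorithm (described in the context) applied to $X_1,\dots,X_n$ with basis $(\phi_1,\dots,\phi_p)$, any conformity score $\hat f$, level $\alpha$ and split size $n_1$. Then $$\mathbb{P}\big\{(\Pi_pX_{n+1})(t)\in B_n(t)\ \text{ for all } t\in[0,1]\big\}\ \ge\ 1-\alpha .$$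
   Context: $\langle f,g\rangle=\int_0^1 f(t)g(t)\,dt$. The functions $\phi_j$ are non-random and everywhere defined on $[0,1]$ (a representative is fixed), so that $\phi_j(t)$ makes sense for every $t$. $\mathbb{P}$ is the probability over $X_1,\dots,X_{n+1}$ (and the random split). Functional conformal prediction band algorithm. 1. Split the data at random (independently of the data values and of $X_{n+1}$) into two parts of sizes $n_1$ and $n_2=n-n_1$; relabel so that the first part is $X_1,\dots,X_{n_1}$ and the second part is $X_{n_1+1},\dots,X_n$. 2. Compute $\xi_{ij}=\langle X_i,\phi_j\rangle$ for $1\le i\le n$, $1\le j\le p$, and put $\xi_i=(\xi_{i1},\dots,\xi_{ip})\in\mathbb{R}^p$. 3. The conformity score is a (measurable) real-valued function $\hat f(\xi)=\hat f(\xi;\xi_1,\dots,\xi_{n_1})$ of $\xi\in\mathbb{R}^p$ that is constructed from $\xi_1,\dots,\xi_{n_1}$ only. Evaluate $\hat f(\xi_i)$ for $i=n_1+1,\dots,n$ and sort these values as $f_1\le f_2\le\dots\le f_{n_2}$. 4. Put $\lambda=f_{\lceil (n_2+1)\alpha\rceil-1}$, with the convention $f_0=-\infty$, and $T_n=\{\xi\in\mathbb{R}^p:\hat f(\xi)\ge\lambda\}$. 5. Output $B_n(t)=\big\{\sum_{j=1}^p\zeta_j\phi_j(t):(\zeta_1,\dots,\zeta_p)\in T_n\big\}$ for each $t\in[0,1]$. *)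

theory Defs
  imports "HOL-Probability.Probability" "HOL-Combinatorics.Permutations"
begin

section \<open>The Hilbert space $L_2[0,1]$\<close>

abbreviation lebesgue01 :: "real measure" where
  "lebesgue01 \<equiv> lebesgue_on {0..1}"

definition square_integrable01 :: "(real \<Rightarrow> real) \<Rightarrow> bool" where
  "square_integrable01 f \<longleftrightarrow>
     f \<in> borel_measurable lebesgue01 \<and> integrable lebesgue01 (\<lambda>t. (f t)\<^sup>2)"

definition L2_rel :: "(real \<Rightarrow> real) \<Rightarrow> (real \<Rightarrow> real) \<Rightarrow> bool" where
  "L2_rel f g \<longleftrightarrow> square_integrable01 f \<and> square_integrable01 g \<and> (AE t in lebesgue01. f t = g t)"

lemma square_integrable01_0: "square_integrable01 (\<lambda>_. 0)"
  by (simp add: square_integrable01_def)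

lemma square_integrable01_mult:
  assumes "square_integrable01 f" "square_integrable01 g"
  shows "integrable lebesgue01 (\<lambda>t. f t * g t)"
proof (rule Bochner_Integration.integrable_bound)
  show "integrable lebesgue01 (\<lambda>t. (f t)\<^sup>2 + (g t)\<^sup>2)"
    using assms by (simp add: square_integrable01_def)
  show "(\<lambda>t. f t * g t) \<in> borel_measurable lebesgue01"
    using assms by (auto simp: square_integrable01_def intro!: borel_measurable_times)
  have "norm (a * b) \<le> norm (a\<^sup>2 + b\<^sup>2)" for a b :: real
  proof -
    have "2 * (\<bar>a\<bar> * \<bar>b\<bar>) \<le> a\<^sup>2 + b\<^sup>2"
      using sum_squares_bound[of "\<bar>a\<bar>" "\<bar>b\<bar>"] by (simp add: mult.assoc)
    moreover have "0 \<le> \<bar>a\<bar> * \<bar>b\<bar>"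
      by simp
    ultimately show ?thesis
      unfolding real_norm_def abs_mult by linarith
  qed
  then show "AE t in lebesgue01. norm (f t * g t) \<le> norm ((f t)\<^sup>2 + (g t)\<^sup>2)"
    by simp
qed

lemma square_integrable01_add:
  assumes "square_integrable01 f" "square_integrable01 g"
  shows "square_integrable01 (\<lambda>t. f t + g t)"
  using assms square_integrable01_mult[OF assms]
  by (auto simp: square_integrable01_def power2_sum mult.assoc intro!: borel_measurable_add)

lemma square_integrable01_scale:
  assumes "square_integrable01 f"
  shows "square_integrable01 (\<lambda>t. c * f t)"
  using assms by (auto simp: square_integrable01_def power_mult_distrib intro!: borel_measurable_times)

lemma square_integrable01_uminus:
  assumes "square_integrable01 f"
  shows "square_integrable01 (\<lambda>t. - f t)"
  using square_integrable01_scale[OF assms, of "-1"] by simp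

lemma square_integrable01_diff:
  assumes "square_integrable01 f" "square_integrable01 g"
  shows "square_integrable01 (\<lambda>t. f t - g t)"
  using square_integrable01_add[OF assms(1) square_integrable01_uminus[OF assms(2)]] by simp

lemma part_equivp_L2_rel: "part_equivp L2_rel"
proof (rule part_equivpI)
  show "\<exists>f. L2_rel f f"
    using square_integrable01_0 by (auto simp: L2_rel_def)
  show "symp L2_rel"
    by (rule sympI) (auto simp: L2_rel_def elim: eventually_mono)
  show "transp L2_rel"
    by (rule transpI) (auto simp: L2_rel_def elim: eventually_elim2)
qed

quotient_type L2 = "real \<Rightarrow> real" / partial: L2_rel
  morphisms rep_L2 L2_class
  by (rule part_equivp_L2_rel)

instantiation L2 :: real_inner
begin

lift_definition zero_L2 :: L2 is "\<lambda>_. 0"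
  by (simp add: L2_rel_def square_integrable01_0)

lift_definition plus_L2 :: "L2 \<Rightarrow> L2 \<Rightarrow> L2" is "\<lambda>f g t. f t + g t"
  by (auto simp: L2_rel_def intro: square_integrable01_add elim: eventually_elim2)

lift_definition minus_L2 :: "L2 \<Rightarrow> L2 \<Rightarrow> L2" is "\<lambda>f g t. f t - g t"
  by (auto simp: L2_rel_def intro: square_integrable01_diff elim: eventually_elim2)

lift_definition uminus_L2 :: "L2 \<Rightarrow> L2" is "\<lambda>f t. - f t"
  by (auto simp: L2_rel_def intro: square_integrable01_uminus elim: eventually_mono)

lift_definition scaleR_L2 :: "real \<Rightarrow> L2 \<Rightarrow> L2" is "\<lambda>c f t. c * f t"
  by (auto simp: L2_rel_def intro: square_integrable01_scale elim: eventually_mono)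

lift_definition inner_L2 :: "L2 \<Rightarrow> L2 \<Rightarrow> real" is "\<lambda>f g. LINT t|lebesgue01. f t * g t"
proof -
  fix f f' g g' assume rel: "L2_rel f f'" "L2_rel g g'"
  then have "AE t in lebesgue01. f t * g t = f' t * g' t"
    by (auto simp: L2_rel_def elim: eventually_elim2)
  then show "(LINT t|lebesgue01. f t * g t) = (LINT t|lebesgue01. f' t * g' t)"
    using rel by (intro integral_cong_AE)
      (auto simp: L2_rel_def square_integrable01_def intro!: borel_measurable_times)
qed

definition norm_L2 :: "L2 \<Rightarrow> real" where "norm_L2 x = sqrt (inner x x)"

definition dist_L2 :: "L2 \<Rightarrow> L2 \<Rightarrow> real" where "dist_L2 x y = norm (x - y)"

definition sgn_L2 :: "L2 \<Rightarrow> L2" where "sgn_L2 x = inverse (norm x) *\<^sub>R x"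

definition uniformity_L2 :: "(L2 \<times> L2) filter" where
  "uniformity_L2 = (INF e\<in>{0<..}. principal {(x, y). dist x y < e})"

definition open_L2 :: "L2 set \<Rightarrow> bool" where
  "open_L2 U = (\<forall>x\<in>U. eventually (\<lambda>(x', y). x' = x \<longrightarrow> y \<in> U) uniformity)"

instance
proof
  fix x y z :: L2 and a b :: real
  show "x + y + z = x + (y + z)" "x + y = y + x" "0 + x = x" "- x + x = 0" "x - y = x + - y"
    "a *\<^sub>R (x + y) = a *\<^sub>R x + a *\<^sub>R y" "(a + b) *\<^sub>R x = a *\<^sub>R x + b *\<^sub>R x"
    "a *\<^sub>R b *\<^sub>R x = (a * b) *\<^sub>R x" "1 *\<^sub>R x = x"
    by (transfer, auto simp: L2_rel_def algebra_simps
          intro: square_integrable01_0 square_integrable01_add square_integrable01_diff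
            square_integrable01_uminus square_integrable01_scale
          dest: square_integrable01_scale square_integrable01_add)+
  show "inner x y = inner y x"
    by transfer (simp add: mult.commute)
  show "inner (x + y) z = inner x z + inner y z"
    by transfer (simp add: L2_rel_def algebra_simps square_integrable01_mult)
  show "inner (a *\<^sub>R x) y = a * inner x y"
    by transfer (simp add: mult.assoc)
  show "0 \<le> inner x x"
    by transfer simp
  show "inner x x = 0 \<longleftrightarrow> x = 0"
  proof transfer
    fix f assume "L2_rel f f"
    then have f: "square_integrable01 f"
      by (simp add: L2_rel_def)
    then have "(LINT t|lebesgue01. f t * f t) = 0 \<longleftrightarrow> (AE t in lebesgue01. f t * f t = 0)"
      by (intro integral_nonneg_eq_0_iff_AE square_integrable01_mult) auto
    then show "(LINT t|lebesgue01. f t * f t) = 0 \<longleftrightarrow> L2_rel f (\<lambda>_. 0)"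
      using f by (simp add: L2_rel_def square_integrable01_0)
  qed
qed (simp_all only: norm_L2_def dist_L2_def sgn_L2_def uniformity_L2_def open_L2_def)

end

lemma inner_L2_class:
  assumes "square_integrable01 f" "square_integrable01 g"
  shows "inner (L2_class f) (L2_class g) = (LINT t|lebesgue01. f t * g t)"
  using assms by (simp add: inner_L2.abs_eq L2_rel_def)


section \<open>The functional conformal prediction band\<close>

text \<open>Basis functions are honest functions (fixed representatives), so that they can be evaluated
  at every point; elements of \<^typ>\<open>L2\<close> are equivalence classes and cannot.\<close>

definition basis_coeffs :: "('p::finite \<Rightarrow> real \<Rightarrow> real) \<Rightarrow> L2 \<Rightarrow> real ^ 'p" where
  "basis_coeffs \<phi> x = (\<chi> j. inner x (L2_class (\<phi> j)))"

definition L2_projection :: "('p::finite \<Rightarrow> real \<Rightarrow> real) \<Rightarrow> L2 \<Rightarrow> real \<Rightarrow> real" where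
  "L2_projection \<phi> x t = (\<Sum>j\<in>UNIV. inner x (L2_class (\<phi> j)) * \<phi> j t)"

text \<open>A conformity score maps the training coefficients, a function on \<open>{1..n1}\<close> that is
  \<^const>\<open>undefined\<close> elsewhere, and a point of $R^p$ to a real number.\<close>

type_synonym 'p score = "(nat \<Rightarrow> real ^ 'p) \<Rightarrow> real ^ 'p \<Rightarrow> real"

text \<open>In the following definitions the data are already relabelled: indices \<open>{1..n1}\<close> form the
  training part and \<open>{n1+1..n}\<close> the calibration part. The order statistic with (one-based)
  index \<open>k\<close> is the list entry at position \<open>k - 1\<close>.\<close>

definition conformal_threshold ::
  "('p::finite) score \<Rightarrow> real \<Rightarrow> nat \<Rightarrow> nat \<Rightarrow> (nat \<Rightarrow> real ^ 'p) \<Rightarrow> ereal" where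
  "conformal_threshold fhat \<alpha> n1 n \<xi> =
    (let fs = sort (map (\<lambda>i. fhat (restrict \<xi> {1..n1}) (\<xi> i)) [n1 + 1..<n + 1]);
         k = nat \<lceil>(real (n - n1) + 1) * \<alpha>\<rceil> - 1
     in if k = 0 then -\<infinity> else ereal (fs ! (k - 1)))"

definition conformal_set ::
  "('p::finite) score \<Rightarrow> real \<Rightarrow> nat \<Rightarrow> nat \<Rightarrow> (nat \<Rightarrow> real ^ 'p) \<Rightarrow> (real ^ 'p) set" where
  "conformal_set fhat \<alpha> n1 n \<xi> =
    {z. ereal (fhat (restrict \<xi> {1..n1}) z) \<ge> conformal_threshold fhat \<alpha> n1 n \<xi>}"

definition conformal_band ::
  "('p::finite \<Rightarrow> real \<Rightarrow> real) \<Rightarrow> 'p score \<Rightarrow> real \<Rightarrow> nat \<Rightarrow> nat \<Rightarrow> (nat \<Rightarrow> L2) \<Rightarrow> real \<Rightarrow> real set" where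
  "conformal_band \<phi> fhat \<alpha> n1 n x t =
    {\<Sum>j\<in>UNIV. \<zeta> $ j * \<phi> j t | \<zeta>. \<zeta> \<in> conformal_set fhat \<alpha> n1 n (\<lambda>i. basis_coeffs \<phi> (x i))}"


section \<open>Probability\<close>

text \<open>The library's notion of independence of two random variables (\<open>indep_var\<close>) needs equal value
  types; here the generated $\sigma$-algebras are required to be independent.\<close>

definition indep_rvs ::
  "'a measure \<Rightarrow> 'b measure \<Rightarrow> ('a \<Rightarrow> 'b) \<Rightarrow> 'c measure \<Rightarrow> ('a \<Rightarrow> 'c) \<Rightarrow> bool" where
  "indep_rvs M N Y K Z \<longleftrightarrow> Y \<in> measurable M N \<and> Z \<in> measurable M K \<and>
     prob_space.indep_set M (sets (vimage_algebra (space M) Y N)) (sets (vimage_algebra (space M) Z K))"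

text \<open>Inner probability. It agrees with \<^const>\<open>measure\<close> on measurable sets. It is needed because
  coverage at all points of $[0,1]$ simultaneously is an uncountable intersection of events, each
  involving a linear image of a Borel set, and such a set need not be measurable (while
  \<^const>\<open>measure\<close> is 0 on non-measurable sets by convention).\<close>

definition inner_prob :: "'a measure \<Rightarrow> 'a set \<Rightarrow> real" where
  "inner_prob M E = (SUP A\<in>{A \<in> sets M. A \<subseteq> E}. measure M A)"

lemma inner_prob_eq_measure:
  assumes "prob_space M" "E \<in> sets M"
  shows "inner_prob M E = measure M E"
proof -
  interpret prob_space M by fact
  show ?thesis
    unfolding inner_prob_def
    by (rule cSup_eq_maximum) (use assms(2) in \<open>auto intro: finite_measure_mono\<close>)
qed

end

theory Submission imports Defs begin

text \<open>Conditionally on the split, the scores of the calibration points and of the new point are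
  exchangeable, because the score depends on the training part only. The new point is not covered
  exactly when its rank among these \<open>n2 + 1\<close> scores is at most \<open>k = \<lceil>(n2 + 1) \<alpha>\<rceil> - 1\<close>. At most \<open>k\<close>
  of the points can have such a rank, so by exchangeability this has probability at most
  \<open>k / (n2 + 1) < \<alpha>\<close>.\<close>

section \<open>Ranks and order statistics\<close>

text \<open>A member of the set with the largest value dominates every other member, so its own rank
  already counts the whole set. Ranks are taken with \<open>\<le>\<close>, so ties are
  harmless.\<close>

lemma card_rank_le:
  fixes v :: "'i \<Rightarrow> 'b::linorder"
  assumes "finite C"
  shows "card {j \<in> C. card {i \<in> C. v i \<le> v j} \<le> k} \<le> k"
proof (cases "{j \<in> C. card {i \<in> C. v i \<le> v j} \<le> k} = {}")
  case True
  show ?thesis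
    unfolding True by simp
next
  case False
  define S where "S = {j \<in> C. card {i \<in> C. v i \<le> v j} \<le> k}"
  have "finite S" "S \<noteq> {}"
    using assms False by (simp_all add: S_def)
  then have "Max (v ` S) \<in> v ` S"
    by simp
  then obtain m where m: "m \<in> S" "v m = Max (v ` S)"
    by auto
  have "S \<subseteq> {i \<in> C. v i \<le> v m}"
    using \<open>finite S\<close> m(2) by (auto simp: S_def)
  then have "card S \<le> card {i \<in> C. v i \<le> v m}"
    using assms by (intro card_mono) auto
  also have "\<dots> \<le> k"
    using m(1) by (simp add: S_def)
  finally show ?thesis
    by (simp add: S_def)
qed

text \<open>Otherwise sortedness would put every entry from position \<open>k - 1\<close> on above
  \<open>z\<close>, leaving at most \<open>k - 1\<close> entries that are
  \<open>\<le> z\<close>.\<close>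

lemma sort_nth_le:
  fixes xs :: "'a::linorder list"
  assumes "0 < k" "k \<le> length (filter (\<lambda>x. x \<le> z) xs)"
  shows "sort xs ! (k - 1) \<le> z"
proof (rule ccontr)
  let ?ys = "sort xs"
  assume "\<not> ?ys ! (k - 1) \<le> z"
  then have gt: "z < ?ys ! i" if "k - 1 \<le> i" "i < length xs" for i
    using sorted_nth_mono[OF sorted_sort that(1), of xs] that by simp
  have "length (filter (\<lambda>x. x \<le> z) xs) = length (filter (\<lambda>x. x \<le> z) ?ys)"
    by (simp add: filter_sort)
  also have "\<dots> = card {i. i < length xs \<and> ?ys ! i \<le> z}"
    by (simp add: length_filter_conv_card)
  also have "\<dots> \<le> card {..<k - 1}"
    using gt by (intro card_mono) (auto simp: not_le[symmetric])
  finally show False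
    using assms by simp
qed

section \<open>Exchangeability and the rank bound\<close>

text \<open>The form in which exchangeability of i.i.d. data enters: for transpositions in the rank
  bound and for the relabelling by the split in the theorem.\<close>

lemma distr_PiM_permutes:
  assumes "prob_space P" "\<sigma> permutes I"
  shows "distr (PiM I (\<lambda>_. P)) (PiM I (\<lambda>_. P)) (\<lambda>y. \<lambda>i\<in>I. y (\<sigma> i)) = PiM I (\<lambda>_. P)"
  using assms
  by (intro distr_PiM_reindex) (auto simp: permutes_in_image intro: permutes_inj_on)

text \<open>The events \<open>B k j\<close> with \<open>j\<close> outside \<open>T\<close> are
  equally likely by exchangeability, and at every sample point at most \<open>k\<close> of them
  occur. Taking the expectation of their number gives the bound.\<close>

lemma conformal_rank_bound:
  fixes s :: "('i \<Rightarrow> 'b) \<Rightarrow> 'b \<Rightarrow> real" and k :: nat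
  assumes P: "prob_space P" and I: "finite I" "T \<subseteq> I" "j\<^sub>0 \<in> I - T"
    and s: "(\<lambda>(x, z). s x z) \<in> borel_measurable (PiM T (\<lambda>_. P) \<Otimes>\<^sub>M P)"
  defines "N \<equiv> PiM I (\<lambda>_. P)"
    and "B \<equiv> \<lambda>k j. {y \<in> space (PiM I (\<lambda>_. P)).
      card {i \<in> I - T. s (restrict y T) (y i) \<le> s (restrict y T) (y j)} \<le> k}"
  shows "B k j\<^sub>0 \<in> sets N" and "card (I - T) * measure N (B k j\<^sub>0) \<le> k"
proof -
  let ?C = "I - T"
  interpret N: prob_space N
    unfolding N_def by (intro prob_space_PiM P)
  have V[measurable]: "(\<lambda>y. s (restrict y T) (y i)) \<in> borel_measurable N" if "i \<in> I - T" for i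
  proof -
    have "(\<lambda>y. (restrict y T, y i)) \<in> N \<rightarrow>\<^sub>M (PiM T (\<lambda>_. P) \<Otimes>\<^sub>M P)"
      unfolding N_def using I that
      by (intro measurable_Pair measurable_restrict_subset measurable_component_singleton) auto
    from measurable_compose[OF this s] show ?thesis
      by simp
  qed
  \<comment> \<open>Writing a cardinality as a finite sum of 0-1 terms makes it accessible to
    measurability proofs.\<close>
  have card_sum: "real (card {i \<in> ?C. Q i}) = (\<Sum>i\<in>?C. if Q i then 1 else 0)" for Q
    using I by (simp add: sum.If_cases Int_def)
  have B_sets: "B k j \<in> sets N" if "j \<in> ?C" for j
  proof -
    have "B k j = {y \<in> space N. (\<Sum>i\<in>?C. if s (restrict y T) (y i) \<le> s (restrict y T) (y j)
        then 1 else 0) \<le> real k}"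
      unfolding B_def N_def card_sum[symmetric] by simp
    also have "\<dots> \<in> sets N"
      using that by measurable
    finally show ?thesis .
  qed
  show "B k j\<^sub>0 \<in> sets N"
    using B_sets I by simp
  have B_eq: "measure N (B k j) = measure N (B k j\<^sub>0)" if "j \<in> ?C" for j
  proof -
    \<comment> \<open>The transposition of \<open>j\<close> and \<open>j\<^sub>0\<close> leaves
      \<open>T\<close> pointwise fixed. Hence the trained score stays the same while the point at
      \<open>j\<close> moves to \<open>j\<^sub>0\<close>, and the relabelled sample \<open>Y\<close>
      still has law \<open>N\<close>.\<close>
    define \<sigma> where "\<sigma> = Transposition.transpose j j\<^sub>0"
    define Y where "Y = (\<lambda>y::'i \<Rightarrow> 'b. \<lambda>i\<in>I. y (\<sigma> i))"
    have \<sigma>I: "\<sigma> permutes I" and \<sigma>C: "\<sigma> permutes ?C"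
      using that I unfolding \<sigma>_def by (auto intro!: permutes_swap_id)
    have distr: "distr N N Y = N"
      unfolding N_def Y_def by (rule distr_PiM_permutes[OF P \<sigma>I])
    have Y: "Y \<in> N \<rightarrow>\<^sub>M N"
      unfolding N_def Y_def using permutes_in_image[OF \<sigma>I]
      by (intro measurable_restrict measurable_component_singleton) auto
    have "card {i \<in> ?C. s (restrict (Y y) T) (Y y i) \<le> s (restrict (Y y) T) (Y y j\<^sub>0)}
        = card {i \<in> ?C. s (restrict y T) (y i) \<le> s (restrict y T) (y j)}" for y
    proof -
      have T: "restrict (Y y) T = restrict y T"
        using I permutes_not_in[OF \<sigma>C] by (intro restrict_ext) (auto simp: Y_def)
      \<comment> \<open>Reindexing along the involution \<open>\<sigma>\<close> turns the rank of
        \<open>j\<close> in \<open>y\<close> into the rank of \<open>j\<^sub>0\<close> in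
        \<open>Y y\<close>.\<close>
      have "{i \<in> ?C. s (restrict y T) (y i) \<le> s (restrict y T) (y j)}
          = \<sigma> ` {i \<in> ?C. s (restrict y T) (y (\<sigma> i)) \<le> s (restrict y T) (y j)}"
        (is "?L = \<sigma> ` ?R")
      proof (intro equalityI subsetI)
        fix i assume "i \<in> ?L"
        moreover have "\<sigma> (\<sigma> i) = i"
          by (simp add: \<sigma>_def)
        ultimately show "i \<in> \<sigma> ` ?R"
          using permutes_in_image[OF \<sigma>C, of i] by (intro image_eqI[of _ _ "\<sigma> i"]) auto
      next
        fix i assume "i \<in> \<sigma> ` ?R"
        then show "i \<in> ?L"
          using permutes_in_image[OF \<sigma>C] by blast
      qed
      then have "card ?L = card (\<sigma> ` ?R)"
        by (rule arg_cong)
      also have "\<dots> = card ?R"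
        by (intro card_image permutes_inj_on[OF \<sigma>C])
      also have "?R = {i \<in> ?C. s (restrict y T) (Y y i) \<le> s (restrict y T) (Y y j\<^sub>0)}"
      proof -
        have "Y y j\<^sub>0 = y j" and "\<And>i. i \<in> ?C \<Longrightarrow> Y y i = y (\<sigma> i)"
          using I by (simp_all add: Y_def \<sigma>_def)
        then show ?thesis
          by auto
      qed
      finally show ?thesis
        unfolding T by (rule sym)
    qed
    then have "Y -` B k j\<^sub>0 \<inter> space N = B k j"
      using measurable_space[OF Y] unfolding B_def N_def by auto
    then show ?thesis
      using measure_distr[OF Y, of "B k j\<^sub>0"] B_sets I distr by simp
  qed
  \<comment> \<open>Double counting: the sum of the probabilities is the expected number of points
    of rank at most \<open>k\<close>, which \<open>card_rank_le\<close> bounds pointwise.\<close>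
  have "card ?C * measure N (B k j\<^sub>0) = (\<Sum>j\<in>?C. measure N (B k j))"
    using B_eq by simp
  also have "\<dots> = (\<Sum>j\<in>?C. N.expectation (indicator (B k j)))"
    using B_sets by (intro sum.cong) (auto simp: N.emeasure_eq_measure)
  also have "\<dots> = N.expectation (\<lambda>y. \<Sum>j\<in>?C. indicator (B k j) y)"
    using B_sets by (subst Bochner_Integration.integral_sum)
      (auto intro!: integrable_real_indicator simp: N.emeasure_eq_measure)
  also have "\<dots> \<le> N.expectation (\<lambda>_. real k)"
  proof (rule integral_mono)
    show "integrable N (\<lambda>y. \<Sum>j\<in>?C. indicator (B k j) y :: real)"
      using B_sets
      by (intro Bochner_Integration.integrable_sum integrable_real_indicator)
        (auto simp: N.emeasure_eq_measure)
    fix y assume "y \<in> space N"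
    then have "(\<Sum>j\<in>?C. indicator (B k j) y) = real (card {j \<in> ?C.
        card {i \<in> ?C. s (restrict y T) (y i) \<le> s (restrict y T) (y j)} \<le> k})"
      unfolding card_sum by (intro sum.cong) (auto simp: B_def N_def indicator_def)
    also have "\<dots> \<le> real k"
      using I by (intro of_nat_mono card_rank_le) simp
    finally show "(\<Sum>j\<in>?C. indicator (B k j) y) \<le> real k" .
  qed simp
  finally show "card ?C * measure N (B k j\<^sub>0) \<le> k"
    by (simp add: N.prob_space)
qed

section \<open>Averaging over an independent random choice\<close>

lemma (in prob_space) indep_rvs_prob:
  assumes "indep_rvs M N Y K Z" "A \<in> sets N" "B \<in> sets K"
  shows "prob {\<omega> \<in> space M. Y \<omega> \<in> A \<and> Z \<omega> \<in> B}
    = prob {\<omega> \<in> space M. Y \<omega> \<in> A} * prob {\<omega> \<in> space M. Z \<omega> \<in> B}"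
proof -
  have "prob ((Y -` A \<inter> space M) \<inter> (Z -` B \<inter> space M))
    = prob (Y -` A \<inter> space M) * prob (Z -` B \<inter> space M)"
    using assms unfolding indep_rvs_def by (intro indep_setD) (auto intro: in_vimage_algebra)
  moreover have "(Y -` A \<inter> space M) \<inter> (Z -` B \<inter> space M) = {\<omega> \<in> space M. Y \<omega> \<in> A \<and> Z \<omega> \<in> B}"
    "Y -` A \<inter> space M = {\<omega> \<in> space M. Y \<omega> \<in> A}" "Z -` B \<inter> space M = {\<omega> \<in> space M. Z \<omega> \<in> B}"
    by auto
  ultimately show ?thesis
    by simp
qed

text \<open>Conditioning on the value of \<open>Y\<close>: on \<open>Y = \<sigma>\<close> the
  expression is \<open>g \<sigma> Z\<close>, and independence gives this piece probability
  \<open>P(Y = \<sigma>) * Q(A)\<close>. The weights sum to 1. In the application \<open>Y\<close>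
  is the random split and \<open>Z\<close> the data.\<close>

lemma (in prob_space) prob_indep_mixture:
  assumes S: "finite S" and indep: "indep_rvs M (count_space S) Y K Z"
    and g: "\<And>\<sigma>. \<sigma> \<in> S \<Longrightarrow> g \<sigma> \<in> K \<rightarrow>\<^sub>M L"
    and distr: "\<And>\<sigma>. \<sigma> \<in> S \<Longrightarrow> distr M L (\<lambda>\<omega>. g \<sigma> (Z \<omega>)) = Q"
    and A: "A \<in> sets L"
  shows "{\<omega> \<in> space M. g (Y \<omega>) (Z \<omega>) \<in> A} \<in> events"
    and "prob {\<omega> \<in> space M. g (Y \<omega>) (Z \<omega>) \<in> A} = measure Q A"
proof -
  have Y: "Y \<in> M \<rightarrow>\<^sub>M count_space S" and Z: "Z \<in> M \<rightarrow>\<^sub>M K"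
    using indep by (auto simp: indep_rvs_def)
  define D where "D \<sigma> = g \<sigma> -` A \<inter> space K" for \<sigma>
  have D: "D \<sigma> \<in> sets K" if "\<sigma> \<in> S" for \<sigma>
    using measurable_sets[OF g[OF that] A] by (simp add: D_def)
  have YS: "Y \<omega> \<in> S" if "\<omega> \<in> space M" for \<omega>
    using measurable_space[OF Y that] by simp
  have ZK: "Z \<omega> \<in> space K" if "\<omega> \<in> space M" for \<omega>
    using measurable_space[OF Z that] .
  have Y_ev: "{\<omega> \<in> space M. Y \<omega> \<in> {\<sigma>}} \<in> events" if "\<sigma> \<in> S" for \<sigma>
    using measurable_sets[OF Y, of "{\<sigma>}"] that by (simp add: vimage_def Int_def conj_commute)
  have Z_ev: "{\<omega> \<in> space M. Z \<omega> \<in> D \<sigma>} \<in> events" if "\<sigma> \<in> S" for \<sigma>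
    using measurable_sets[OF Z D[OF that]] by (simp add: vimage_def Int_def conj_commute)
  have ev: "{\<omega> \<in> space M. Y \<omega> \<in> {\<sigma>} \<and> Z \<omega> \<in> D \<sigma>} \<in> events" if "\<sigma> \<in> S" for \<sigma>
    using sets.sets_Collect_conj[OF Z_ev[OF that] Y_ev[OF that]] .
  \<comment> \<open>Since \<open>S\<close> is finite, this disjoint decomposition gives both the
    measurability of the event and its probability.\<close>
  have split: "{\<omega> \<in> space M. g (Y \<omega>) (Z \<omega>) \<in> A}
      = (\<Union>\<sigma>\<in>S. {\<omega> \<in> space M. Y \<omega> \<in> {\<sigma>} \<and> Z \<omega> \<in> D \<sigma>})"
    using YS ZK by (auto simp: D_def)
  show "{\<omega> \<in> space M. g (Y \<omega>) (Z \<omega>) \<in> A} \<in> events"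
    unfolding split using S ev by blast
  have Q: "prob {\<omega> \<in> space M. Z \<omega> \<in> D \<sigma>} = measure Q A" if "\<sigma> \<in> S" for \<sigma>
  proof -
    have "measure Q A = measure (distr M L (\<lambda>\<omega>. g \<sigma> (Z \<omega>))) A"
      using distr[OF that] by simp
    also have "\<dots> = prob ((\<lambda>\<omega>. g \<sigma> (Z \<omega>)) -` A \<inter> space M)"
      using measurable_compose[OF Z g[OF that]] A by (rule measure_distr)
    also have "(\<lambda>\<omega>. g \<sigma> (Z \<omega>)) -` A \<inter> space M = {\<omega> \<in> space M. Z \<omega> \<in> D \<sigma>}"
      using ZK by (auto simp: D_def)
    finally show ?thesis
      by simp
  qed
  have "prob {\<omega> \<in> space M. g (Y \<omega>) (Z \<omega>) \<in> A}
      = (\<Sum>\<sigma>\<in>S. prob {\<omega> \<in> space M. Y \<omega> \<in> {\<sigma>} \<and> Z \<omega> \<in> D \<sigma>})"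
    unfolding split using S ev
    by (intro finite_measure_finite_Union) (auto simp: disjoint_family_on_def)
  also have "\<dots> = (\<Sum>\<sigma>\<in>S. prob {\<omega> \<in> space M. Y \<omega> \<in> {\<sigma>}} * measure Q A)"
    by (intro sum.cong refl, subst indep_rvs_prob[OF indep _ D]) (auto simp: Q)
  also have "\<dots> = (\<Sum>\<sigma>\<in>S. prob {\<omega> \<in> space M. Y \<omega> \<in> {\<sigma>}}) * measure Q A"
    by (simp add: sum_distrib_right)
  also have "(\<Sum>\<sigma>\<in>S. prob {\<omega> \<in> space M. Y \<omega> \<in> {\<sigma>}}) = prob (\<Union>\<sigma>\<in>S. {\<omega> \<in> space M. Y \<omega> \<in> {\<sigma>}})"
    using S Y_ev by (intro finite_measure_finite_Union[symmetric]) (auto simp: disjoint_family_on_def)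
  also have "(\<Union>\<sigma>\<in>S. {\<omega> \<in> space M. Y \<omega> \<in> {\<sigma>}}) = space M"
    using YS by auto
  finally show "prob {\<omega> \<in> space M. g (Y \<omega>) (Z \<omega>) \<in> A} = measure Q A"
    by (simp add: prob_space)
qed

section \<open>From ranks to membership in the band\<close>

lemma basis_coeffs_measurable: "basis_coeffs \<phi> \<in> borel_measurable borel"
  unfolding basis_coeffs_def
  by (intro borel_measurable_continuous_onI continuous_intros)

text \<open>The coefficient vector of \<open>z\<close> is a witness that does not depend on
  \<open>t\<close>, which is why coverage holds at all points simultaneously.\<close>

lemma L2_projection_in_conformal_band:
  assumes "basis_coeffs \<phi> z \<in> conformal_set fhat \<alpha> n1 n (\<lambda>i. basis_coeffs \<phi> (x i))"
  shows "L2_projection \<phi> z t \<in> conformal_band \<phi> fhat \<alpha> n1 n x t"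
  using assms unfolding conformal_band_def L2_projection_def basis_coeffs_def
  by (auto intro!: exI[of _ "\<chi> j. inner z (L2_class (\<phi> j))"])

text \<open>The rank of the new point counts the point itself. A rank above \<open>k\<close>
  therefore leaves at least \<open>k\<close> calibration scores not exceeding the new score, so the
  order statistic of index \<open>k\<close> does not exceed it either.\<close>

lemma in_conformal_set_if_rank:
  fixes \<xi> :: "nat \<Rightarrow> real ^ 'p::finite" and fhat :: "'p score" and n1 :: nat
  defines "v \<equiv> \<lambda>i. fhat (restrict \<xi> {1..n1}) (\<xi> i)"
  assumes "n1 < n"
    and rank: "nat \<lceil>(real (n - n1) + 1) * \<alpha>\<rceil> - 1
      < card {i \<in> {1..n + 1} - {1..n1}. v i \<le> v (n + 1)}"
  shows "\<xi> (n + 1) \<in> conformal_set fhat \<alpha> n1 n \<xi>"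
proof -
  define k where "k = nat \<lceil>(real (n - n1) + 1) * \<alpha>\<rceil> - 1"
  have "{i \<in> {1..n + 1} - {1..n1}. v i \<le> v (n + 1)}
      = insert (n + 1) {i \<in> {n1 + 1..<n + 1}. v i \<le> v (n + 1)}"
    using \<open>n1 < n\<close> by auto
  then have "k \<le> card {i \<in> {n1 + 1..<n + 1}. v i \<le> v (n + 1)}"
    using rank by (simp add: k_def)
  also have "\<dots> = length (filter (\<lambda>x. x \<le> v (n + 1)) (map v [n1 + 1..<n + 1]))"
    by (simp add: filter_map comp_def distinct_card[symmetric] del: upt_Suc)
  \<comment> \<open>For \<open>k = 0\<close> the threshold is \<open>-\<infinity>\<close> and
    nothing has to be shown; the list position \<open>k - 1\<close> matters only for positive
    \<open>k\<close>.\<close>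
  finally have "sort (map v [n1 + 1..<n + 1]) ! (k - 1) \<le> v (n + 1)" if "k \<noteq> 0"
    using that by (intro sort_nth_le) auto
  then have "conformal_threshold fhat \<alpha> n1 n \<xi> \<le> ereal (v (n + 1))"
    unfolding conformal_threshold_def Let_def k_def[symmetric] v_def[symmetric] by simp
  then show ?thesis
    by (simp add: conformal_set_def v_def)
qed

section \<open>The coverage probability\<close>

text \<open>The split is modelled by a random permutation \<open>\<pi>\<close> of
  \<open>{1..n}\<close>, of arbitrary law, independent of all \<open>n + 1\<close> curves jointly.
  Position \<open>i\<close> of the relabelled sample holds the curve with index
  \<open>\<pi> \<omega> i\<close>.\<close>

theorem proposition3p1:
  fixes M :: "'a measure" and P :: "L2 measure"
    and X :: "nat \<Rightarrow> 'a \<Rightarrow> L2" and \<pi> :: "'a \<Rightarrow> nat \<Rightarrow> nat"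
    and \<phi> :: "'p::finite \<Rightarrow> real \<Rightarrow> real"
    and fhat :: "(nat \<Rightarrow> real ^ 'p) \<Rightarrow> real ^ 'p \<Rightarrow> real"
    and \<alpha> :: real and n n1 :: nat
  assumes "prob_space P" and "sets P = sets borel"
    and "prob_space M"
    and "prob_space.indep_vars M (\<lambda>_. borel) X {1..n + 1}"
    and "\<And>i. i \<in> {1..n + 1} \<Longrightarrow> distr M borel (X i) = P"
    and "indep_rvs M (count_space {\<sigma>. \<sigma> permutes {1..n}}) \<pi>
           (PiM {1..n + 1} (\<lambda>_. borel)) (\<lambda>\<omega>. \<lambda>i\<in>{1..n + 1}. X i \<omega>)"
    and "0 < \<alpha>" and "\<alpha> < 1" and "1 \<le> n1" and "n1 < n"
    and "\<And>j. square_integrable01 (\<phi> j)"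
    and "\<And>i j. inner (L2_class (\<phi> i)) (L2_class (\<phi> j)) = (if i = j then 1 else 0)"
    and "(\<lambda>(\<xi>, z). fhat \<xi> z) \<in> borel_measurable (PiM {1..n1} (\<lambda>_. borel) \<Otimes>\<^sub>M borel)"
  shows "inner_prob M {\<omega> \<in> space M. \<forall>t\<in>{0..1}.
           L2_projection \<phi> (X (n + 1) \<omega>) t \<in> conformal_band \<phi> fhat \<alpha> n1 n (\<lambda>i. X (\<pi> \<omega> i) \<omega>) t}
         \<ge> 1 - \<alpha>"
proof -
  interpret P: prob_space P by fact
  interpret M: prob_space M by fact
  let ?I = "{1..n + 1}" and ?T = "{1..n1}"
  let ?L = "PiM ?I (\<lambda>_. borel :: L2 measure)"
  let ?N = "PiM ?I (\<lambda>_. P)"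
  let ?S = "{\<sigma>. \<sigma> permutes {1..n}}"
  define Z where "Z = (\<lambda>\<omega>. \<lambda>i\<in>?I. X i \<omega>)"
  define k where "k = nat \<lceil>(real (n - n1) + 1) * \<alpha>\<rceil> - 1"
  \<comment> \<open>The score is expressed through the curves themselves, so that the rank bound
    applies to the product of copies of \<open>P\<close>.\<close>
  define s where "s x z = fhat (\<lambda>i\<in>?T. basis_coeffs \<phi> (x i)) (basis_coeffs \<phi> z)"
    for x :: "nat \<Rightarrow> L2" and z
  define g where "g \<sigma> y = (\<lambda>i\<in>?I. y (\<sigma> i))" for \<sigma> :: "nat \<Rightarrow> nat" and y :: "nat \<Rightarrow> L2"
  \<comment> \<open>The rank event that contains all failures of coverage, stated for an already
    relabelled sample.\<close>
  define B where "B = {y \<in> space ?N. card {i \<in> ?I - ?T.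
      s (restrict y ?T) (y i) \<le> s (restrict y ?T) (y (n + 1))} \<le> k}"
  note sets_P = \<open>sets P = sets borel\<close>
  \<comment> \<open>The data are measurable with respect to powers of \<open>borel\<close>, while
    their law is a power of \<open>P\<close>; the two products have the same measurable
    sets.\<close>
  have sets_N: "sets ?N = sets ?L"
    by (intro sets_PiM_cong) (simp_all add: sets_P)
  have coeffs: "basis_coeffs \<phi> \<in> borel_measurable P"
    using basis_coeffs_measurable measurable_cong_sets[OF sets_P refl] by blast
  have s: "(\<lambda>(x, z). s x z) \<in> borel_measurable (PiM ?T (\<lambda>_. P) \<Otimes>\<^sub>M P)"
  proof -
    have "(\<lambda>(x, z). (\<lambda>i\<in>?T. basis_coeffs \<phi> (x i), basis_coeffs \<phi> z))
        \<in> PiM ?T (\<lambda>_. P) \<Otimes>\<^sub>M P \<rightarrow>\<^sub>M PiM ?T (\<lambda>_. borel) \<Otimes>\<^sub>M borel"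
      using coeffs by measurable
    from measurable_compose[OF this assms(13)] show ?thesis
      by (simp add: s_def split_beta')
  qed
  have "finite ?I" "?T \<subseteq> ?I" "n + 1 \<in> ?I - ?T"
    using \<open>n1 < n\<close> by auto
  note rank_bound = conformal_rank_bound[OF P.prob_space_axioms this s, of k, folded B_def]
  have B: "B \<in> sets ?N"
    by (fact rank_bound)
  have "card (?I - ?T) * measure ?N B \<le> k"
    by (fact rank_bound)
  moreover have "card (?I - ?T) = n - n1 + 1"
    using \<open>n1 < n\<close> by (subst card_Diff_subset) auto
  \<comment> \<open>A ceiling minus 1 lies strictly below its argument; positivity of the argument
    keeps the subtraction on naturals from truncating.\<close>
  moreover have "real k < (real (n - n1) + 1) * \<alpha>"
  proof -
    have "0 < (real (n - n1) + 1) * \<alpha>"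
      using \<open>0 < \<alpha>\<close> by simp
    then show ?thesis
      unfolding k_def by linarith
  qed
  ultimately have "(real (n - n1) + 1) * measure ?N B \<le> (real (n - n1) + 1) * \<alpha>"
    by (simp only: of_nat_add of_nat_1)
  then have B_le: "measure ?N B \<le> \<alpha>"
    by (subst (asm) mult_le_cancel_left_pos) auto
  have distr_Z: "distr M ?L Z = ?N"
  proof -
    have "\<And>i. i \<in> ?I \<Longrightarrow> X i \<in> M \<rightarrow>\<^sub>M borel"
      using assms(4) by (auto simp: M.indep_vars_def)
    then have "distr M ?L Z = PiM ?I (\<lambda>i. distr M borel (X i))"
      using assms(4) M.indep_vars_iff_distr_eq_PiM'[of ?I X "\<lambda>_. borel"] unfolding Z_def by auto
    also have "\<dots> = ?N"
      using assms(5) by (intro PiM_cong) auto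
    finally show ?thesis .
  qed
  have perm: "\<sigma> permutes ?I" if "\<sigma> \<in> ?S" for \<sigma>
    using that by (auto intro: permutes_subset)
  have indep: "indep_rvs M (count_space ?S) \<pi> ?L Z"
    using assms(6) unfolding Z_def .
  then have Z: "Z \<in> M \<rightarrow>\<^sub>M ?L" and \<pi>: "\<pi> \<in> M \<rightarrow>\<^sub>M count_space ?S"
    by (auto simp: indep_rvs_def)
  have g: "g \<sigma> \<in> ?L \<rightarrow>\<^sub>M ?L" if "\<sigma> \<in> ?S" for \<sigma>
    unfolding g_def using permutes_in_image[OF perm[OF that]]
    by (intro measurable_restrict measurable_component_singleton) auto
  have distr_g: "distr M ?L (\<lambda>\<omega>. g \<sigma> (Z \<omega>)) = ?N" if "\<sigma> \<in> ?S" for \<sigma>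
  proof -
    have "distr M ?L (\<lambda>\<omega>. g \<sigma> (Z \<omega>)) = distr (distr M ?L Z) ?L (g \<sigma>)"
      using distr_distr[OF g[OF that] Z] by (simp add: comp_def)
    also have "\<dots> = distr ?N ?N (g \<sigma>)"
      unfolding distr_Z by (intro distr_cong refl sets_N[symmetric])
    also have "\<dots> = ?N"
      unfolding g_def by (rule distr_PiM_permutes[OF P.prob_space_axioms perm[OF that]])
    finally show ?thesis .
  qed
  have "finite ?S" and B_L: "B \<in> sets ?L"
    using B sets_N by (simp_all add: finite_permutations)
  \<comment> \<open>Every fixed relabelling preserves the law of the sample, hence so does the
    random one, being independent of the data.\<close>
  note mixture = M.prob_indep_mixture[where g = g, OF \<open>finite ?S\<close> indep g distr_g B_L]
  have ev: "{\<omega> \<in> space M. g (\<pi> \<omega>) (Z \<omega>) \<in> B} \<in> M.events"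
    by (rule mixture(1))
  have pr: "M.prob {\<omega> \<in> space M. g (\<pi> \<omega>) (Z \<omega>) \<in> B} = measure ?N B"
    by (rule mixture(2))
  \<comment> \<open>\<open>?G\<close> is measurable and, as shown next, contained in the possibly
    non-measurable coverage event \<open>?E\<close>. Its probability is thus a lower bound for the
    inner probability.\<close>
  let ?G = "space M - {\<omega> \<in> space M. g (\<pi> \<omega>) (Z \<omega>) \<in> B}"
  let ?E = "{\<omega> \<in> space M. \<forall>t\<in>{0..1}.
    L2_projection \<phi> (X (n + 1) \<omega>) t \<in> conformal_band \<phi> fhat \<alpha> n1 n (\<lambda>i. X (\<pi> \<omega> i) \<omega>) t}"
  have "?G \<subseteq> ?E"
  proof
    fix \<omega> assume \<omega>: "\<omega> \<in> ?G"
    define y where "y = g (\<pi> \<omega>) (Z \<omega>)"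
    define \<xi> where "\<xi> = (\<lambda>i. basis_coeffs \<phi> (X (\<pi> \<omega> i) \<omega>))"
    have \<pi>_perm: "\<pi> \<omega> permutes {1..n}"
      using measurable_space[OF \<pi>, of \<omega>] \<omega> by simp
    \<comment> \<open>The split moves only the first \<open>n\<close> indices, so the last
      coordinate of \<open>y\<close> is the new curve.\<close>
    then have "\<pi> \<omega> (n + 1) = n + 1"
      by (intro permutes_not_in) auto
    have y_space: "y \<in> space ?N"
      using measurable_space[OF g measurable_space[OF Z], of "\<pi> \<omega>" \<omega>] \<omega> \<pi>_perm
        sets_eq_imp_space_eq[OF sets_N] by (simp add: y_def)
    have y: "y i = X (\<pi> \<omega> i) \<omega>" if "i \<in> ?I" for i
      using that permutes_in_image[OF perm, of "\<pi> \<omega>" i] \<pi>_perm by (simp add: y_def g_def Z_def)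
    \<comment> \<open>Restricting the curves before taking coefficients gives the same training
      input as restricting the coefficients: both are \<open>undefined\<close> off
      \<open>?T\<close>.\<close>
    have "s (restrict y ?T) (y i) = fhat (restrict \<xi> ?T) (\<xi> i)" if "i \<in> ?I" for i
    proof -
      have "(\<lambda>i\<in>?T. basis_coeffs \<phi> (restrict y ?T i)) = restrict \<xi> ?T"
        using y \<open>n1 < n\<close> by (auto simp: \<xi>_def restrict_def)
      then show ?thesis
        using y[OF that] by (simp add: s_def \<xi>_def)
    qed
    then have "{i \<in> ?I - ?T. s (restrict y ?T) (y i) \<le> s (restrict y ?T) (y (n + 1))}
      = {i \<in> ?I - ?T. fhat (restrict \<xi> ?T) (\<xi> i) \<le> fhat (restrict \<xi> ?T) (\<xi> (n + 1))}"
      by auto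
    moreover have "\<not> card {i \<in> ?I - ?T. s (restrict y ?T) (y i) \<le> s (restrict y ?T) (y (n + 1))} \<le> k"
      using \<omega> y_space unfolding B_def y_def by blast
    ultimately have "k < card {i \<in> ?I - ?T.
        fhat (restrict \<xi> ?T) (\<xi> i) \<le> fhat (restrict \<xi> ?T) (\<xi> (n + 1))}"
      by (simp only: not_le)
    then have "\<xi> (n + 1) \<in> conformal_set fhat \<alpha> n1 n \<xi>"
      using \<open>n1 < n\<close> unfolding k_def by (intro in_conformal_set_if_rank)
    then show "\<omega> \<in> ?E"
      using \<omega> \<open>\<pi> \<omega> (n + 1) = n + 1\<close> unfolding \<xi>_def
      by (auto intro: L2_projection_in_conformal_band)
  qed
  have "1 - \<alpha> \<le> M.prob ?G"
    using B_le M.prob_compl[OF ev] pr by simp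
  also have "\<dots> \<le> inner_prob M ?E"
    unfolding inner_prob_def using ev \<open>?G \<subseteq> ?E\<close>
    by (intro cSUP_upper bdd_aboveI2[where M = 1]) auto
  finally show ?thesis .
qed

end
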